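(* For every $n\ge 1$, the group $\mathrm{PSL}_2(\mathbb{F}_{2^n})$ is mixable.
   Context: A finite group $G$ is mixable if there exist fixed elements $g_1,\dots,g_k\in G$ and independent Bernoulli random variables $\epsilon_i\sim\mathrm{Ber}(p_i)$, $p_i\in[0,1]$, such that the random product $g_1^{\epsilon_1}\cdots g_k^{\epsilon_k}$ is distributed exactly uniformly on $G$. *)

theory Defs
  imports "HOL-Analysis.Determinants" "HOL-Algebra.Coset"
begin

text \<open>Ordered product g_1^{e_1} ... g_k^{e_k} in a group G, for a list of elements
  and a list of exponents in {0,1} (encoded as booleans).\<close>
definition sel_prod :: "('g, 'b) monoid_scheme \<Rightarrow> 'g list \<Rightarrow> bool list \<Rightarrow> 'g" where
  "sel_prod G gs es = foldr (\<lambda>(g, e) acc. (if e then g else \<one>\<^bsub>G\<^esub>) \<otimes>\<^bsub>G\<^esub> acc) (zip gs es) \<one>\<^bsub>G\<^esub>"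

text \<open>Probability of an outcome vector es under independent Bernoulli(p_i) variables.\<close>
definition bern_weight :: "real list \<Rightarrow> bool list \<Rightarrow> real" where
  "bern_weight ps es = (\<Prod>i<length ps. if es ! i then ps ! i else 1 - ps ! i)"

definition mixable :: "('g, 'b) monoid_scheme \<Rightarrow> bool" where
  "mixable G \<longleftrightarrow> (\<exists>gs ps. length ps = length gs \<and> set gs \<subseteq> carrier G
      \<and> (\<forall>p\<in>set ps. 0 \<le> p \<and> p \<le> 1)
      \<and> (\<forall>h\<in>carrier G.
           (\<Sum>es\<in>{es. length es = length gs \<and> sel_prod G gs es = h}. bern_weight ps es)
             = 1 / real (card (carrier G))))"

text \<open>SL_2(F) as a group of 2x2 matrices over the field 'a.\<close>
definition SL2 :: "(('a::field)^2^2) monoid" where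
  "SL2 = \<lparr>carrier = {A. det A = 1}, monoid.mult = (**), one = mat 1\<rparr>"

text \<open>PSL_2(F) = SL_2(F) / {I, -I}.\<close>
definition PSL2 :: "(('a::field)^2^2) set monoid" where
  "PSL2 = SL2 Mod {mat 1, - mat 1}"

end

theory Submission
  imports Defs "HOL-Algebra.Multiplicative_Group" "HOL-Analysis.Complex_Transcendental"
begin

text \<open>In characteristic two \<open>-I = I\<close>, so \<open>PSL\<^sub>2(\<bbbF>\<^sub>q) = SL\<^sub>2(\<bbbF>\<^sub>q)\<close> and we need a random
  product that is uniform on \<open>SL\<^sub>2\<close>. The rightmost factors are all unipotent elements \<open>u\<^sub>c\<close>, each taken
  with probability \<open>1/2\<close>; their product is uniform on the unipotent group \<open>U\<close>. All later factors
  multiply from the left, so the law stays right \<open>U\<close>-invariant and is determined by the law of its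
  first column, a density on the nonzero vectors of \<open>\<bbbF>\<^sub>q\<^sup>2\<close>. Blocks consisting of a Weyl element
  followed by all of \<open>U\<close> keep that density \<open>U\<close>-invariant, i.e. given by two functions \<open>g, h\<close> on
  \<open>\<bbbF>\<^sub>q\<^sup>*\<close>. In the characters of the cyclic group \<open>\<bbbF>\<^sub>q\<^sup>*\<close>, a Weyl step with probability
  \<open>\<surd>q/(1+\<surd>q)\<close> makes the nontrivial Fourier coefficients of \<open>g\<close> and \<open>h\<close> proportional, and a
  suitable diagonal element followed by such a Weyl step annihilates any prescribed frequency while
  keeping the others at zero. Once all frequencies are killed, \<open>g\<close> and \<open>h\<close> are constant, a final Weyl
  step with probability \<open>q/(q+1)\<close> makes the two constants equal, and a right \<open>U\<close>-invariant law with
  uniform first column is uniform on \<open>SL\<^sub>2\<close>.\<close>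

section \<open>Fields of characteristic two\<close>

lemma of_nat_CARD_eq_0: "of_nat CARD('a::{ring_1,finite}) = (0::'a)"
proof -
  have "(\<Sum>y\<in>UNIV. y + 1) = (\<Sum>y\<in>(UNIV::'a set). y)"
    by (rule sum.reindex_bij_witness[of _ "\<lambda>y. y - 1" "\<lambda>y. y + 1"]) auto
  then show ?thesis
    by (simp add: sum.distrib)
qed

lemma CHAR_eq_2_if_CARD_eq_power_2:
  assumes "CARD('a::{field,finite}) = 2 ^ n"
  shows "CHAR('a) = 2"
proof -
  have "(2::'a) ^ n = 0"
    using of_nat_CARD_eq_0[where 'a='a] assms by simp
  then have "CHAR('a) dvd 2"
    using of_nat_eq_0_iff_char_dvd[where 'a='a, of 2] by simp
  moreover have "CHAR('a) > 0"
    by (simp add: finite_imp_CHAR_pos)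
  ultimately show ?thesis
    using CHAR_not_1[where 'a='a] dvd_imp_le[of "CHAR('a)" 2] by linarith
qed

lemma add_self_CHAR_2: "CHAR('a::ring_1) = 2 \<Longrightarrow> (x::'a) + x = 0"
  using minus_CHAR_2[of x x] by simp

section \<open>Two-by-two matrices\<close>

definition mat2 :: "'a::comm_ring_1 \<Rightarrow> 'a \<Rightarrow> 'a \<Rightarrow> 'a \<Rightarrow> 'a^2^2" where
  "mat2 a b c d = vector [vector [a, b], vector [c, d]]"

lemma mat2_nth [simp]:
  "mat2 a b c d $ 1 $ 1 = a" "mat2 a b c d $ 1 $ 2 = b"
  "mat2 a b c d $ 2 $ 1 = c" "mat2 a b c d $ 2 $ 2 = d"
  by (simp_all add: mat2_def)

lemma mat2_eq_iff:
  "(A::'a^2^2) = B \<longleftrightarrow> A$1$1 = B$1$1 \<and> A$1$2 = B$1$2 \<and> A$2$1 = B$2$1 \<and> A$2$2 = B$2$2"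
  by (auto simp: vec_eq_iff forall_2)

lemma matrix_mult_2_nth [simp]:
  "((A::'a::comm_ring_1^2^2) ** B) $ 1 $ 1 = A$1$1 * B$1$1 + A$1$2 * B$2$1"
  "(A ** B) $ 1 $ 2 = A$1$1 * B$1$2 + A$1$2 * B$2$2"
  "(A ** B) $ 2 $ 1 = A$2$1 * B$1$1 + A$2$2 * B$2$1"
  "(A ** B) $ 2 $ 2 = A$2$1 * B$1$2 + A$2$2 * B$2$2"
  by (simp_all add: matrix_matrix_mult_def sum_2)

lemma mat_1_2_nth [simp]:
  "(mat 1 :: 'a::comm_ring_1^2^2) $ 1 $ 1 = 1" "(mat 1 :: 'a::comm_ring_1^2^2) $ 1 $ 2 = 0"
  "(mat 1 :: 'a::comm_ring_1^2^2) $ 2 $ 1 = 0" "(mat 1 :: 'a::comm_ring_1^2^2) $ 2 $ 2 = 1"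
  by (simp_all add: mat_def)

definition adj2 :: "'a::comm_ring_1^2^2 \<Rightarrow> 'a^2^2" where
  "adj2 A = mat2 (A$2$2) (- A$1$2) (- A$2$1) (A$1$1)"

lemma det_adj2 [simp]: "det (adj2 A) = det A"
  by (simp add: adj2_def det_2 algebra_simps)

lemma adj2_mult:
  assumes "det A = 1"
  shows "adj2 A ** A = mat 1" and "A ** adj2 A = mat 1"
  using assms by (simp_all add: mat2_eq_iff adj2_def det_2 algebra_simps)

lemma adj2_mult_cancel:
  assumes "det A = 1"
  shows "adj2 A ** (A ** B) = B" and "A ** (adj2 A ** B) = B"
  by (simp_all add: matrix_mul_assoc adj2_mult[OF assms])

lemma mult_eq_iff_eq_adj2_mult: "det A = 1 \<Longrightarrow> A ** B = C \<longleftrightarrow> B = adj2 A ** C"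
  using adj2_mult_cancel by metis

definition act :: "'a::comm_ring_1^2^2 \<Rightarrow> 'a \<times> 'a \<Rightarrow> 'a \<times> 'a" where
  "act A v = (A$1$1 * fst v + A$1$2 * snd v, A$2$1 * fst v + A$2$2 * snd v)"

lemma act_mult: "act (A ** B) v = act A (act B v)"
  by (simp add: act_def algebra_simps)

lemma act_mat_1 [simp]: "act (mat 1) v = v"
  by (simp add: act_def)

lemma act_adj2_cancel:
  assumes "det A = 1"
  shows "act (adj2 A) (act A v) = v" and "act A (act (adj2 A) v) = v"
  using adj2_mult_cancel[OF assms, of "mat 1"] by (simp_all flip: act_mult)

definition first_column :: "'a::comm_ring_1^2^2 \<Rightarrow> 'a \<times> 'a" where
  "first_column C = act C (1, 0)"

lemma first_column_nonzero: "det C = 1 \<Longrightarrow> first_column C \<noteq> (0, 0)"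
  by (auto simp: first_column_def act_def det_2)

definition unip :: "'a::comm_ring_1 \<Rightarrow> 'a^2^2" where
  "unip c = mat2 1 c 0 1"

lemma unip_nth [simp]:
  "unip c $ 1 $ 1 = 1" "unip c $ 1 $ 2 = c" "unip c $ 2 $ 1 = 0" "unip c $ 2 $ 2 = 1"
  by (simp_all add: unip_def)

lemma unip_add: "unip b ** unip c = unip (b + c)"
  by (simp add: mat2_eq_iff add.commute)

lemma unip_0 [simp]: "unip 0 = mat 1"
  by (simp add: mat2_eq_iff)

lemma det_unip [simp]: "det (unip c) = 1"
  by (simp add: det_2)

lemma unip_eq_iff [simp]: "unip b = unip c \<longleftrightarrow> b = c"
  by (auto simp: mat2_eq_iff)

lemma adj2_unip: "CHAR('a::comm_ring_1) = 2 \<Longrightarrow> adj2 (unip (c::'a)) = unip c"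
  by (simp add: mat2_eq_iff adj2_def uminus_CHAR_2)

lemma act_unip: "act (unip c) (x, y) = (x + c * y, y)"
  by (simp add: act_def)

definition weyl :: "'a::comm_ring_1^2^2" where
  "weyl = mat2 0 1 1 0"

lemma det_weyl: "CHAR('a::comm_ring_1) = 2 \<Longrightarrow> det (weyl :: 'a^2^2) = 1"
  by (simp add: weyl_def det_2 uminus_CHAR_2[of "1::'a"])

lemma act_adj2_weyl: "CHAR('a::comm_ring_1) = 2 \<Longrightarrow> act (adj2 weyl) (v::'a \<times> 'a) = (snd v, fst v)"
  by (simp add: weyl_def adj2_def act_def uminus_CHAR_2)

definition diag :: "'a::field \<Rightarrow> 'a^2^2" where
  "diag s = mat2 s 0 0 (inverse s)"

lemma det_diag: "s \<noteq> 0 \<Longrightarrow> det (diag s) = 1"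
  by (simp add: diag_def det_2)

lemma act_adj2_diag: "act (adj2 (diag s)) v = (inverse s * fst v, s * snd v)"
  by (simp add: diag_def adj2_def act_def)

lemma first_column_eq_iff:
  assumes "det A = 1" and "det C = 1"
  shows "first_column A = first_column C \<longleftrightarrow> (\<exists>c. A = C ** unip c)"
proof
  assume "first_column A = first_column C"
  then have "first_column (adj2 C ** A) = (1, 0)"
    using act_adj2_cancel(1)[OF assms(2)] by (simp add: first_column_def act_mult)
  moreover have "det (adj2 C ** A) = 1"
    using assms by (simp add: det_mul)
  ultimately have "adj2 C ** A = unip ((adj2 C ** A) $ 1 $ 2)"
    by (simp add: mat2_eq_iff first_column_def act_def det_2)
  then show "\<exists>c. A = C ** unip c"
    using adj2_mult_cancel(2)[OF assms(2), of A] by metis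
qed (auto simp: first_column_def act_mult act_unip)


section \<open>Random products as iterated lazy steps\<close>

definition lazy_step :: "('x \<Rightarrow> 'x) \<Rightarrow> real \<Rightarrow> ('x \<Rightarrow> real) \<Rightarrow> 'x \<Rightarrow> real" where
  "lazy_step t p f x = (1 - p) * f x + p * f (t x)"

text \<open>If \<open>f\<close> is the density of \<open>X\<close>, then \<open>walk (**) [(g, p)] f\<close> is the density of \<open>g\<^sup>\<epsilon> X\<close> with
  \<open>\<epsilon> \<sim> Ber(p)\<close>; so \<open>walk (**) L\<close> applied to the point mass at \<open>mat 1\<close> is the law of the random
  product of the list \<open>L\<close>. The action \<open>T\<close> lets the same walk act on other densities.\<close>
definition walk :: "('a::comm_ring_1^2^2 \<Rightarrow> 'x \<Rightarrow> 'x) \<Rightarrow> (('a^2^2) \<times> real) list \<Rightarrow> ('x \<Rightarrow> real) \<Rightarrow> 'x \<Rightarrow> real" where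
  "walk T L f = foldr (\<lambda>(g, p). lazy_step (T (adj2 g)) p) L f"

lemma walk_Nil [simp]: "walk T [] f = f"
  and walk_Cons [simp]: "walk T (gp # L) f = lazy_step (T (adj2 (fst gp))) (snd gp) (walk T L f)"
  and walk_append: "walk T (L @ M) f = walk T L (walk T M f)"
  by (simp_all add: walk_def case_prod_unfold)

lemma bern_weight_Cons:
  "bern_weight (p # ps) (e # es) = (if e then p else 1 - p) * bern_weight ps es"
  unfolding bern_weight_def by (subst length_Cons, subst prod.lessThan_Suc_shift) (auto intro!: prod.cong)

lemma sel_prod_Cons:
  "sel_prod G (g # gs) (e # es) = (if e then g else \<one>\<^bsub>G\<^esub>) \<otimes>\<^bsub>G\<^esub> sel_prod G gs es"
  by (simp add: sel_prod_def)

lemma sum_bool_lists_Suc: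
  fixes f :: "bool list \<Rightarrow> 'b::comm_monoid_add"
  shows "(\<Sum>es | length es = Suc n \<and> P es. f es) =
    (\<Sum>es | length es = n \<and> P (True # es). f (True # es)) +
    (\<Sum>es | length es = n \<and> P (False # es). f (False # es))"
proof -
  have fin: "finite {es::bool list. length es = n \<and> Q es}" for Q
    using finite_lists_length_eq[of "UNIV :: bool set" n] by (auto intro: finite_subset)
  have "{es. length es = Suc n \<and> P es} =
      Cons True ` {es. length es = n \<and> P (True # es)} \<union> Cons False ` {es. length es = n \<and> P (False # es)}"
    (is "?S = ?T")
  proof (intro equalityI subsetI)
    fix es assume "es \<in> ?S"
    then obtain e es' where "es = e # es'" "length es' = n" "P (e # es')"
      by (auto simp: length_Suc_conv)
    then show "es \<in> ?T"
      by (cases e) auto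
  qed auto
  then have "(\<Sum>es\<in>?S. f es) = (\<Sum>es\<in>?T. f es)"
    by simp
  also have "\<dots> = (\<Sum>es | length es = n \<and> P (True # es). f (True # es)) +
    (\<Sum>es | length es = n \<and> P (False # es). f (False # es))"
    by (subst sum.union_disjoint) (auto simp: fin sum.reindex)
  finally show ?thesis .
qed

lemma sum_bern_weight_sel_prod_SL2:
  assumes "length ps = length gs" and "\<forall>g\<in>set gs. det g = 1"
  shows "(\<Sum>es | length es = length gs \<and> sel_prod SL2 gs es = C. bern_weight ps es) =
    walk (**) (zip gs ps) (indicator {mat 1}) C"
  using assms
proof (induction gs arbitrary: ps C)
  case Nil
  then show ?case
    by (simp add: bern_weight_def sel_prod_def SL2_def indicator_def)
next
  case (Cons g gs)
  then obtain p ps' where ps: "ps = p # ps'" and len: "length ps' = length gs"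
    by (cases ps) auto
  have "det g = 1"
    using Cons.prems by simp
  then have left_mult: "g ** X = C \<longleftrightarrow> X = adj2 g ** C" for X
    by (rule mult_eq_iff_eq_adj2_mult)
  have "(\<Sum>es | length es = length (g # gs) \<and> sel_prod SL2 (g # gs) es = C. bern_weight ps es) =
      p * (\<Sum>es | length es = length gs \<and> sel_prod SL2 gs es = adj2 g ** C. bern_weight ps' es) +
      (1 - p) * (\<Sum>es | length es = length gs \<and> sel_prod SL2 gs es = C. bern_weight ps' es)"
    by (simp add: ps sum_bool_lists_Suc sel_prod_Cons bern_weight_Cons sum_distrib_left)
      (simp add: SL2_def left_mult)
  then show ?case
    using Cons.IH[of ps'] Cons.prems len by (simp add: ps lazy_step_def)
qed

lemma PSL2_CHAR_2:
  assumes "CHAR('a::field) = 2"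
  shows carrier_PSL2_CHAR_2: "carrier (PSL2 :: ('a^2^2) set monoid) = (\<lambda>C. {C}) ` {C. det C = 1}"
    and mult_PSL2_CHAR_2: "{A} \<otimes>\<^bsub>(PSL2 :: ('a^2^2) set monoid)\<^esub> {B} = {A ** B}"
    and one_PSL2_CHAR_2: "\<one>\<^bsub>(PSL2 :: ('a^2^2) set monoid)\<^esub> = {mat 1}"
proof -
  have "- mat 1 = (mat 1 :: 'a^2^2)"
    by (simp add: mat2_eq_iff uminus_CHAR_2[OF assms])
  then have center: "{mat 1, - mat 1} = {mat 1 :: 'a^2^2}"
    by simp
  show "carrier (PSL2 :: ('a^2^2) set monoid) = (\<lambda>C. {C}) ` {C. det C = 1}"
    by (auto simp: PSL2_def FactGroup_def RCOSETS_def r_coset_def center SL2_def)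
  show "{A} \<otimes>\<^bsub>(PSL2 :: ('a^2^2) set monoid)\<^esub> {B} = {A ** B}"
    by (simp add: PSL2_def FactGroup_def set_mult_def SL2_def)
  show "\<one>\<^bsub>(PSL2 :: ('a^2^2) set monoid)\<^esub> = {mat 1}"
    by (simp add: PSL2_def FactGroup_def center)
qed

lemma sel_prod_PSL2_CHAR_2:
  assumes "CHAR('a::field) = 2"
  shows "sel_prod (PSL2 :: ('a^2^2) set monoid) (map (\<lambda>A. {A}) gs) es = {sel_prod SL2 gs es}"
proof (induction gs arbitrary: es)
  case Nil
  then show ?case
    by (simp add: sel_prod_def one_PSL2_CHAR_2[OF assms] SL2_def)
next
  case (Cons g gs)
  then show ?case
    by (cases es) (simp_all add: sel_prod_def PSL2_CHAR_2[OF assms] SL2_def)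
qed

lemma mixable_PSL2_if_walk_uniform:
  assumes "CHAR('a::{field,finite}) = 2"
    and L: "\<forall>(g, p)\<in>set L. det g = 1 \<and> 0 \<le> p \<and> p \<le> 1"
    and uniform: "\<forall>C::'a^2^2. det C = 1 \<longrightarrow>
      walk (**) L (indicator {mat 1}) C = 1 / card {C::'a^2^2. det C = 1}"
  shows "mixable (PSL2 :: ('a^2^2) set monoid)"
  unfolding mixable_def
proof (intro exI conjI ballI)
  let ?gs = "map (\<lambda>A. {A}) (map fst L)" and ?ps = "map snd L"
  show "length ?ps = length ?gs" and "set ?gs \<subseteq> carrier PSL2"
    using L by (auto simp: carrier_PSL2_CHAR_2[OF assms(1)])
  show "0 \<le> p" "p \<le> 1" if "p \<in> set ?ps" for p
    using L that by auto
  fix h assume "h \<in> carrier (PSL2 :: ('a^2^2) set monoid)"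
  then obtain C where h: "h = {C}" and "det C = 1"
    by (auto simp: carrier_PSL2_CHAR_2[OF assms(1)])
  have "card (carrier (PSL2 :: ('a^2^2) set monoid)) = card {C::'a^2^2. det C = 1}"
    unfolding carrier_PSL2_CHAR_2[OF assms(1)] by (rule card_image) (auto simp: inj_on_def)
  moreover have "{es. length es = length ?gs \<and> sel_prod PSL2 ?gs es = h} =
      {es. length es = length (map fst L) \<and> sel_prod SL2 (map fst L) es = C}"
    by (simp add: h sel_prod_PSL2_CHAR_2[OF assms(1)] del: map_map)
  ultimately show "(\<Sum>es | length es = length ?gs \<and> sel_prod PSL2 ?gs es = h. bern_weight ?ps es) =
      1 / real (card (carrier (PSL2 :: ('a^2^2) set monoid)))"
    using sum_bern_weight_sel_prod_SL2[of ?ps "map fst L" C] L uniform \<open>det C = 1\<close>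
    by (fastforce simp: zip_map_fst_snd)
qed

section \<open>Averaging over the unipotent subgroup\<close>

definition orbit_average :: "('a::finite \<Rightarrow> 'x \<Rightarrow> 'x) \<Rightarrow> ('x \<Rightarrow> real) \<Rightarrow> 'x \<Rightarrow> real" where
  "orbit_average T f x = (\<Sum>c\<in>UNIV. f (T c x)) / CARD('a)"

lemma foldr_half_lazy_steps_eq_orbit_average:
  fixes T :: "'a::{ring_1,finite} \<Rightarrow> 'x \<Rightarrow> 'x"
  assumes "CHAR('a) = 2" and T_0: "\<And>x. T 0 x = x" and T_add: "\<And>b c x. T b (T c x) = T (b + c) x"
    and "set cs = UNIV"
  shows "foldr (\<lambda>c. lazy_step (T c) (1/2)) cs f = orbit_average T f"
proof -
  define W where "W cs = foldr (\<lambda>c. lazy_step (T c) (1/2)) cs f" for cs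
  have W_Cons: "W (c # cs) x = (W cs x + W cs (T c x)) / 2" for c cs x
    by (simp add: W_def lazy_step_def)
  have invariant: "W cs (T b x) = W cs x" if "b \<in> set cs" for b cs x
    using that
  proof (induction cs arbitrary: x)
    case (Cons c cs)
    show ?case
    proof (cases "b = c")
      case True
      then have "T c (T b x) = x"
        by (metis T_0 T_add add_self_CHAR_2[OF assms(1)])
      then show ?thesis
        using True by (simp add: W_Cons add.commute)
    next
      case False
      then have "b \<in> set cs"
        using Cons.prems by simp
      moreover have "T c (T b x) = T b (T c x)"
        by (simp add: T_add add.commute)
      ultimately show ?thesis
        using Cons.IH by (simp add: W_Cons)
    qed
  qed simp
  have sum_orbit: "(\<Sum>c\<in>UNIV. W cs (T c x)) = (\<Sum>c\<in>UNIV. f (T c x))" for cs x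
  proof (induction cs)
    case (Cons b cs)
    have "(\<Sum>c\<in>UNIV. W cs (T b (T c x))) = (\<Sum>c\<in>UNIV. W cs (T c x))"
      unfolding T_add by (rule sum.reindex_bij_witness[of _ "\<lambda>c. c - b" "\<lambda>c. b + c"]) auto
    then show ?case
      using Cons.IH by (simp add: W_Cons sum_divide_distrib[symmetric] sum.distrib)
  qed (simp add: W_def)
  have "real CARD('a) * W cs x = (\<Sum>c\<in>UNIV. f (T c x))" for x
    using sum_orbit[of cs x] invariant assms(4) by simp
  then show ?thesis
    by (simp add: fun_eq_iff orbit_average_def W_def field_simps)
qed

definition unipotent_steps :: "(('a::{field,finite}^2^2) \<times> real) list" where
  "unipotent_steps = map (\<lambda>c. (unip c, 1/2)) (SOME cs. set cs = UNIV)"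

lemma valid_unipotent_steps: "\<forall>(g, p)\<in>set unipotent_steps. det g = 1 \<and> 0 \<le> p \<and> p \<le> 1"
  by (auto simp: unipotent_steps_def)

lemma walk_unipotent_steps:
  fixes T :: "'a::{field,finite}^2^2 \<Rightarrow> 'x \<Rightarrow> 'x"
  assumes "CHAR('a) = 2"
    and T_mult: "\<And>A B x. T (A ** B) x = T A (T B x)" and T_1: "\<And>x. T (mat 1) x = x"
  shows "walk T unipotent_steps f = orbit_average (\<lambda>c. T (unip c)) f"
proof -
  have "set (SOME cs. set cs = (UNIV::'a set)) = UNIV"
    by (rule someI_ex) (simp add: finite_list)
  moreover have "T (unip b) (T (unip c) x) = T (unip (b + c)) x" for b c x
    by (simp flip: T_mult unip_add)
  ultimately show ?thesis
    unfolding walk_def unipotent_steps_def foldr_map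
    by (simp add: o_def adj2_unip[OF assms(1)] foldr_half_lazy_steps_eq_orbit_average[OF assms(1)] T_1)
qed

lemma orbit_average_unip_indicator:
  assumes "CHAR('a::{field,finite}) = 2"
  shows "orbit_average (\<lambda>c C. unip c ** C) (indicator {mat 1}) C =
    indicator (range unip) (C::'a^2^2) / CARD('a)"
proof -
  have "unip c ** C = mat 1 \<longleftrightarrow> C = unip c" for c
    using mult_eq_iff_eq_adj2_mult[of "unip c" C "mat 1"] by (simp add: adj2_unip[OF assms])
  then have "(\<Sum>c\<in>UNIV. indicator {mat 1} (unip c ** C)) = (\<Sum>c\<in>UNIV. indicator {C} (unip c) :: real)"
    by (intro sum.cong) (auto simp: indicator_def)
  also have "\<dots> = indicator (range unip) C"
    by (cases "C \<in> range unip") (auto simp: indicator_def)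
  finally show ?thesis
    by (simp add: orbit_average_def)
qed

section \<open>Densities on matrices and their first columns\<close>

definition right_unip_invariant :: "('a::comm_ring_1^2^2 \<Rightarrow> real) \<Rightarrow> bool" where
  "right_unip_invariant D \<longleftrightarrow> (\<forall>C c. D (C ** unip c) = D C)"

lemma right_unip_invariant_walk:
  "right_unip_invariant D \<Longrightarrow> right_unip_invariant (walk (**) L D)"
  by (induction L) (auto simp: right_unip_invariant_def lazy_step_def matrix_mul_assoc)

lemma right_unip_invariant_indicator_range_unip:
  "right_unip_invariant (\<lambda>C. indicator (range unip) C / r)"
proof -
  have "C ** unip c \<in> range unip \<longleftrightarrow> C \<in> range unip" for C :: "'a::comm_ring_1^2^2" and c
  proof
    assume "C ** unip c \<in> range unip"
    then obtain d where "C ** unip c = unip d"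
      by auto
    then have "C = unip d ** unip (- c)"
      by (metis matrix_mul_assoc matrix_mul_rid unip_add unip_0 add.right_inverse)
    then show "C \<in> range unip"
      by (simp add: unip_add)
  qed (auto simp: unip_add)
  then show ?thesis
    by (simp add: right_unip_invariant_def indicator_def)
qed

definition supported_on_SL2 :: "('a::comm_ring_1^2^2 \<Rightarrow> real) \<Rightarrow> bool" where
  "supported_on_SL2 D \<longleftrightarrow> (\<forall>C. D C \<noteq> 0 \<longrightarrow> det C = 1)"

lemma supported_on_SL2_walk:
  assumes "supported_on_SL2 D" and "\<forall>(g, p)\<in>set L. det g = 1"
  shows "supported_on_SL2 (walk (**) L D)"
  using assms(2)
proof (induction L)
  case (Cons gp L)
  then have IH: "supported_on_SL2 (walk (**) L D)" and "det (fst gp) = 1"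
    by (auto simp: case_prod_unfold)
  show ?case
    unfolding supported_on_SL2_def
  proof (intro allI impI)
    fix C assume "walk (**) (gp # L) D C \<noteq> 0"
    then have "walk (**) L D C \<noteq> 0 \<or> walk (**) L D (adj2 (fst gp) ** C) \<noteq> 0"
      by (auto simp: lazy_step_def)
    then show "det C = 1"
      using IH \<open>det (fst gp) = 1\<close> by (auto simp: supported_on_SL2_def det_mul)
  qed
qed (use assms(1) in simp)

lemma bij_adj2_mult: "det g = 1 \<Longrightarrow> bij ((**) (adj2 g))"
  by (rule o_bij[of "(**) g"]) (simp_all add: fun_eq_iff adj2_mult_cancel)

lemma sum_lazy_step:
  fixes f :: "'x::finite \<Rightarrow> real"
  assumes "bij t"
  shows "(\<Sum>x\<in>UNIV. lazy_step t p f x) = (\<Sum>x\<in>UNIV. f x)"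
proof -
  have "(\<Sum>x\<in>UNIV. f (t x)) = (\<Sum>x\<in>UNIV. f x)"
    using assms by (rule sum.reindex_bij_betw)
  then show ?thesis
    by (simp add: lazy_step_def sum.distrib flip: sum_distrib_left) (simp add: algebra_simps)
qed

lemma sum_walk:
  fixes D :: "'a::{field,finite}^2^2 \<Rightarrow> real"
  assumes "\<forall>(g, p)\<in>set L. det g = 1"
  shows "(\<Sum>C\<in>UNIV. walk (**) L D C) = (\<Sum>C\<in>UNIV. D C)"
  using assms by (induction L) (auto simp: sum_lazy_step bij_adj2_mult case_prod_unfold)

definition pushforward :: "('x::finite \<Rightarrow> 'y) \<Rightarrow> ('x \<Rightarrow> real) \<Rightarrow> 'y \<Rightarrow> real" where
  "pushforward \<pi> f y = (\<Sum>x | \<pi> x = y. f x)"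

lemma pushforward_lazy_step:
  fixes \<pi> :: "'x::finite \<Rightarrow> 'y"
  assumes "bij s" and "inj t" and \<pi>_s: "\<And>x. \<pi> (s x) = t (\<pi> x)"
  shows "pushforward \<pi> (lazy_step s p f) = lazy_step t p (pushforward \<pi> f)"
proof
  fix y
  have "s ` {x. \<pi> x = y} = {z. \<pi> z = t y}"
  proof (intro equalityI subsetI)
    fix z assume "z \<in> {z. \<pi> z = t y}"
    moreover obtain x where "z = s x"
      using assms(1) by (metis bij_pointE)
    ultimately show "z \<in> s ` {x. \<pi> x = y}"
      using assms(2) by (auto simp: \<pi>_s inj_eq)
  qed (auto simp: \<pi>_s)
  then have "bij_betw s {x. \<pi> x = y} {z. \<pi> z = t y}"
    using assms(1) by (auto simp: bij_def intro: bij_betw_imageI inj_on_subset)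
  then have "(\<Sum>x | \<pi> x = y. f (s x)) = pushforward \<pi> f (t y)"
    by (simp add: pushforward_def sum.reindex_bij_betw)
  then show "pushforward \<pi> (lazy_step s p f) y = lazy_step t p (pushforward \<pi> f) y"
    by (simp add: pushforward_def lazy_step_def sum.distrib flip: sum_distrib_left)
qed

lemma pushforward_first_column_walk:
  fixes D :: "'a::{field,finite}^2^2 \<Rightarrow> real"
  assumes "\<forall>(g, p)\<in>set L. det g = 1"
  shows "pushforward first_column (walk (**) L D) = walk act L (pushforward first_column D)"
  using assms
proof (induction L)
  case (Cons gp L)
  have "det (fst gp) = 1"
    using Cons.prems by (auto simp: case_prod_unfold)
  then have "inj (act (adj2 (fst gp)))"
    by (metis act_adj2_cancel(2) det_adj2 injI)
  with \<open>det (fst gp) = 1\<close> show ?case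
    using Cons by (simp add: pushforward_lazy_step bij_adj2_mult first_column_def act_mult case_prod_unfold)
qed simp

lemma pushforward_first_column_indicator_1:
  "pushforward first_column (indicator {mat 1 :: 'a::{field,finite}^2^2}) = indicator {(1, 0)}"
  by (auto simp: fun_eq_iff pushforward_def indicator_def first_column_def)

lemma density_eq_pushforward_first_column:
  fixes D :: "'a::{field,finite}^2^2 \<Rightarrow> real"
  assumes "right_unip_invariant D" and "supported_on_SL2 D" and "det C = 1"
  shows "D C = pushforward first_column D (first_column C) / CARD('a)"
proof -
  have "inj (\<lambda>c. C ** unip c)"
    by (rule injI) (metis adj2_mult_cancel(1)[OF assms(3)] unip_eq_iff)
  have fiber: "{A. first_column A = first_column C \<and> det A = 1} = range (\<lambda>c. C ** unip c)"
    using first_column_eq_iff[OF _ assms(3)] assms(3) by (auto simp: det_mul)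
  have "real CARD('a) * D C = (\<Sum>c\<in>UNIV. D (C ** unip c))"
    using assms(1) by (simp add: right_unip_invariant_def)
  also have "\<dots> = (\<Sum>A\<in>range (\<lambda>c. C ** unip c). D A)"
    by (simp add: sum.reindex[OF \<open>inj (\<lambda>c. C ** unip c)\<close>])
  also have "\<dots> = (\<Sum>A | first_column A = first_column C. D A)"
    unfolding fiber[symmetric] using assms(2)
    by (intro sum.mono_neutral_left) (auto simp: supported_on_SL2_def)
  finally show ?thesis
    by (simp add: pushforward_def field_simps)
qed

lemma walk_uniform_if_pushforward_constant:
  fixes L :: "(('a::{field,finite}^2^2) \<times> real) list"
  defines "D \<equiv> walk (**) (L @ unipotent_steps) (indicator {mat 1})"
  assumes "CHAR('a) = 2" and dets: "\<forall>(g, p)\<in>set L. det g = 1"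
    and const: "\<And>v. v \<noteq> (0, 0) \<Longrightarrow> pushforward first_column D v = K"
  shows "\<forall>C::'a^2^2. det C = 1 \<longrightarrow> D C = 1 / card {C::'a^2^2. det C = 1}"
proof -
  have dets': "\<forall>(g, p)\<in>set (L @ unipotent_steps). det g = 1"
    using dets valid_unipotent_steps by fastforce
  have "walk (**) unipotent_steps f = orbit_average (\<lambda>c. (**) (unip c)) f" for f :: "'a^2^2 \<Rightarrow> real"
    by (rule walk_unipotent_steps[OF assms(2)]) (simp_all add: matrix_mul_assoc)
  then have "walk (**) unipotent_steps (indicator {mat 1 :: 'a^2^2}) = (\<lambda>C. indicator (range unip) C / CARD('a))"
    using orbit_average_unip_indicator[OF assms(2)] by auto
  then have "right_unip_invariant D"
    unfolding D_def walk_append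
    by (simp add: right_unip_invariant_walk right_unip_invariant_indicator_range_unip)
  moreover have "supported_on_SL2 D"
    unfolding D_def by (rule supported_on_SL2_walk[OF _ dets']) (simp add: supported_on_SL2_def indicator_def)
  ultimately have D_eq: "D C = K / CARD('a)" if "det C = 1" for C
    using density_eq_pushforward_first_column const first_column_nonzero that by metis
  have "1 = (\<Sum>C\<in>UNIV. D C)"
    unfolding D_def sum_walk[OF dets'] by (simp add: indicator_def)
  also have "\<dots> = (\<Sum>C | det C = 1. D C)"
    using \<open>supported_on_SL2 D\<close> by (intro sum.mono_neutral_right) (auto simp: supported_on_SL2_def)
  also have "\<dots> = card {C::'a^2^2. det C = 1} * (K / CARD('a))"
    by (simp add: D_eq)
  finally have "K / CARD('a) = 1 / card {C::'a^2^2. det C = 1}"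
    by (metis nonzero_eq_divide_eq mult.commute mult_zero_left zero_neq_one)
  then show ?thesis
    using D_eq by simp
qed

section \<open>Unipotent-invariant densities on vectors\<close>

type_synonym 'a orbit_data = "('a \<Rightarrow> real) \<times> ('a \<Rightarrow> real)"

text \<open>The orbits of the unipotent group on nonzero vectors are the lines \<open>{(x, y) | x}\<close>, \<open>y \<noteq> 0\<close>,
  and the points \<open>(x, 0)\<close>, \<open>x \<noteq> 0\<close>; a unipotent-invariant function vanishing at the origin is
  given by its values \<open>g y\<close> and \<open>h x\<close> on them.\<close>
definition orbit_fun :: "'a::field orbit_data \<Rightarrow> 'a \<times> 'a \<Rightarrow> real" where
  "orbit_fun gh v = (if snd v \<noteq> 0 then fst gh (snd v) else if fst v \<noteq> 0 then snd gh (fst v) else 0)"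

fun weyl_step :: "real \<Rightarrow> 'a::{field,finite} orbit_data \<Rightarrow> 'a orbit_data" where
  "weyl_step p (g, h) =
    (\<lambda>y. (1 - p) * g y + p / CARD('a) * (h y + (\<Sum>z\<in>UNIV - {0}. g z)), \<lambda>x. (1 - p) * h x + p * g x)"

fun diag_step :: "'a::field \<Rightarrow> real \<Rightarrow> 'a orbit_data \<Rightarrow> 'a orbit_data" where
  "diag_step s p (g, h) = (\<lambda>y. (1 - p) * g y + p * g (s * y), \<lambda>x. (1 - p) * h x + p * h (inverse s * x))"

definition weyl_steps :: "real \<Rightarrow> (('a::{field,finite}^2^2) \<times> real) list" where
  "weyl_steps p = unipotent_steps @ [(weyl, p)]"

lemma valid_weyl_steps:
  assumes "CHAR('a::{field,finite}) = 2" and "0 \<le> p" and "p \<le> 1"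
  shows "\<forall>(g, p')\<in>set (weyl_steps p :: (('a^2^2) \<times> real) list). det g = 1 \<and> 0 \<le> p' \<and> p' \<le> 1"
  using valid_unipotent_steps det_weyl[OF assms(1)] assms(2,3) by (auto simp: weyl_steps_def)

lemma walk_act_unipotent_steps:
  "CHAR('a::{field,finite}) = 2 \<Longrightarrow>
    walk act unipotent_steps f = orbit_average (\<lambda>c. act (unip (c::'a))) f"
  by (rule walk_unipotent_steps) (simp_all add: act_mult)

lemma sum_orbit_fun_row:
  assumes "y \<noteq> 0"
  shows "(\<Sum>z\<in>UNIV. orbit_fun (g, h) (y, z::'a::{field,finite})) = h y + (\<Sum>z\<in>UNIV - {0}. g z)"
proof -
  have "(\<Sum>z\<in>UNIV. orbit_fun (g, h) (y, z)) = orbit_fun (g, h) (y, 0) + (\<Sum>z\<in>UNIV - {0}. orbit_fun (g, h) (y, z))"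
    by (rule sum.remove) auto
  then show ?thesis
    using assms by (auto simp: orbit_fun_def intro!: sum.cong)
qed

lemma walk_weyl_steps_orbit_fun:
  assumes "CHAR('a::{field,finite}) = 2"
  shows "walk act (weyl_steps p) (orbit_fun st) = orbit_fun (weyl_step p (st :: 'a orbit_data))"
proof
  fix v :: "'a \<times> 'a"
  obtain g h where st: "st = (g, h)"
    by (cases st)
  obtain x y where v: "v = (x, y)"
    by (cases v)
  let ?f = "orbit_fun (g, h)" and ?q = "real CARD('a)"
  have "?q * walk act (weyl_steps p) ?f v =
      (\<Sum>c\<in>UNIV. (1 - p) * ?f (x + c * y, y) + p * ?f (y, x + c * y))"
    by (simp add: weyl_steps_def walk_append walk_act_unipotent_steps[OF assms] orbit_average_def
        v act_unip lazy_step_def act_adj2_weyl[OF assms])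
  also have "\<dots> = ?q * orbit_fun (weyl_step p (g, h)) v"
  proof (cases "y = 0")
    case True
    then show ?thesis
      by (simp add: v orbit_fun_def)
  next
    case False
    have row: "?f (x + c * y, y) = g y" for c
      using False by (simp add: orbit_fun_def)
    have "(\<Sum>c\<in>UNIV. ?f (y, x + c * y)) = (\<Sum>z\<in>UNIV. ?f (y, z))"
      by (rule sum.reindex_bij_witness[of _ "\<lambda>z. (z - x) / y" "\<lambda>c. x + c * y"])
        (use False in \<open>auto simp: field_simps\<close>)
    also have "\<dots> = h y + (\<Sum>z\<in>UNIV - {0}. g z)"
      by (rule sum_orbit_fun_row[OF False])
    finally have "(\<Sum>c\<in>UNIV. (1 - p) * ?f (x + c * y, y) + p * ?f (y, x + c * y)) =
        ?q * ((1 - p) * g y) + p * (h y + (\<Sum>z\<in>UNIV - {0}. g z))"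
      by (simp add: row sum.distrib flip: sum_distrib_left)
    also have "\<dots> = ?q * orbit_fun (weyl_step p (g, h)) v"
      using False by (simp add: v orbit_fun_def field_simps)
    finally show ?thesis .
  qed
  finally show "walk act (weyl_steps p) (orbit_fun st) v = orbit_fun (weyl_step p st) v"
    by (simp add: st)
qed

lemma walk_diag_orbit_fun:
  "s \<noteq> 0 \<Longrightarrow> walk act [(diag s, p)] (orbit_fun (g, h)) = orbit_fun (diag_step s p (g, h))"
  by (simp add: fun_eq_iff lazy_step_def act_adj2_diag orbit_fun_def)

lemma walk_unipotent_steps_indicator:
  assumes "CHAR('a::{field,finite}) = 2"
  shows "walk act unipotent_steps (indicator {(1, 0)}) = orbit_fun (\<lambda>_. 0, indicator {1 :: 'a})"
proof
  fix v :: "'a \<times> 'a"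
  obtain x y where v: "v = (x, y)"
    by (cases v)
  show "walk act unipotent_steps (indicator {(1, 0)}) v = orbit_fun (\<lambda>_. 0, indicator {1}) v"
    by (cases "y = 0")
      (simp_all add: walk_act_unipotent_steps[OF assms] orbit_average_def v act_unip orbit_fun_def indicator_def)
qed

lemma orbit_fun_weyl_step_equalizes:
  fixes g h :: "'a::{field,finite} \<Rightarrow> real" and a b :: real
  assumes g: "\<And>y. y \<noteq> 0 \<Longrightarrow> g y = a" and h: "\<And>x. x \<noteq> 0 \<Longrightarrow> h x = b" and "v \<noteq> (0, 0)"
  shows "orbit_fun (weyl_step (real CARD('a) / (real CARD('a) + 1)) (g, h)) v =
    (real CARD('a) * a + b) / (real CARD('a) + 1)"
proof -
  let ?q = "real CARD('a)"
  have arith: "(1 - q / (q + 1)) * a + q / (q + 1) / q * (b + (q - 1) * a) = (q * a + b) / (q + 1)"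
    "(1 - q / (q + 1)) * b + q / (q + 1) * a = (q * a + b) / (q + 1)" if "q > 0" for q :: real
  proof -
    have "q \<noteq> 0" and "q + 1 \<noteq> 0"
      using that by auto
    then have e1: "1 - q / (q + 1) = 1 / (q + 1)" and e2: "q / (q + 1) / q = 1 / (q + 1)"
      by (simp add: field_simps, simp)
    show "(1 - q / (q + 1)) * a + q / (q + 1) / q * (b + (q - 1) * a) = (q * a + b) / (q + 1)"
      unfolding e1 e2 using \<open>q + 1 \<noteq> 0\<close> by (simp add: divide_simps) (simp add: algebra_simps)
    show "(1 - q / (q + 1)) * b + q / (q + 1) * a = (q * a + b) / (q + 1)"
      unfolding e1 using \<open>q + 1 \<noteq> 0\<close> by (simp add: divide_simps)
  qed
  have "(\<Sum>z\<in>UNIV - {0}. g z) = (\<Sum>z\<in>UNIV - {0::'a}. a)"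
    by (rule sum.cong) (auto simp: g)
  also have "\<dots> = (?q - 1) * a"
    by (simp add: card_Diff_singleton of_nat_diff Suc_le_eq)
  finally have sum_g: "(\<Sum>z\<in>UNIV - {0}. g z) = (?q - 1) * a" .
  have "fst (weyl_step (?q / (?q + 1)) (g, h)) y = (?q * a + b) / (?q + 1)" if "y \<noteq> 0" for y
  proof -
    have "fst (weyl_step (?q / (?q + 1)) (g, h)) y =
        (1 - ?q / (?q + 1)) * a + ?q / (?q + 1) / ?q * (b + (?q - 1) * a)"
      using that by (simp add: g h sum_g)
    also have "\<dots> = (?q * a + b) / (?q + 1)"
      by (rule arith(1)) simp
    finally show ?thesis .
  qed
  moreover have "snd (weyl_step (?q / (?q + 1)) (g, h)) x = (?q * a + b) / (?q + 1)" if "x \<noteq> 0" for x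
  proof -
    have "snd (weyl_step (?q / (?q + 1)) (g, h)) x = (1 - ?q / (?q + 1)) * b + ?q / (?q + 1) * a"
      using that by (simp add: g h)
    also have "\<dots> = (?q * a + b) / (?q + 1)"
      by (rule arith(2)) simp
    finally show ?thesis .
  qed
  ultimately show ?thesis
    using assms(3) by (auto simp: orbit_fun_def prod_eq_iff)
qed

definition balance :: "real \<Rightarrow> real" where
  "balance q = sqrt q / (1 + sqrt q)"

lemma balance_identities:
  fixes q :: real
  assumes "q > 0"
  shows "sqrt q * (1 - balance q) = balance q" and "sqrt q * (balance q / q) = 1 - balance q"
proof -
  define r where "r = sqrt q"
  have "r > 0" and q: "q = r * r"
    using assms by (simp_all add: r_def)
  then show "sqrt q * (1 - balance q) = balance q" and "sqrt q * (balance q / q) = 1 - balance q"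
    unfolding balance_def r_def[symmetric] by (simp_all add: q divide_simps)
qed

lemma balance_bounds:
  assumes "q \<ge> 0"
  shows "0 \<le> balance q \<and> balance q \<le> 1"
proof -
  have "1 + sqrt q > 0"
    using assms by (metis add_pos_nonneg real_sqrt_ge_zero zero_less_one)
  then show ?thesis
    using assms by (auto simp: balance_def divide_le_eq_1)
qed

section \<open>Characters of the multiplicative group of a finite field\<close>

definition field_ring :: "'a::field ring" where
  "field_ring = \<lparr>carrier = UNIV, monoid.mult = (*), one = 1, zero = 0, add = (+)\<rparr>"

lemma field_field_ring: "field (field_ring :: 'a::field ring)"
proof -
  have "\<exists>y. x + y = 0" for x :: 'a
    using add.right_inverse by blast
  moreover have "x \<noteq> 0 \<Longrightarrow> \<exists>y. x * y = 1" for x :: 'a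
    by (rule exI[of _ "inverse x"]) simp
  ultimately show ?thesis
    unfolding field_ring_def by unfold_locales (auto simp: algebra_simps Units_def)
qed

lemma power_card_minus_1:
  assumes "(x::'a::{field,finite}) \<noteq> 0"
  shows "x ^ (CARD('a) - 1) = 1"
proof -
  have "(\<Prod>y\<in>UNIV - {0}. x * y) = (\<Prod>y\<in>UNIV - {0::'a}. y)"
    by (rule prod.reindex_bij_witness[of _ "\<lambda>y. y / x" "\<lambda>y. x * y"]) (use assms in auto)
  moreover have "(\<Prod>y\<in>UNIV - {0}. x * y) = x ^ (CARD('a) - 1) * (\<Prod>y\<in>UNIV - {0::'a}. y)"
    by (simp add: prod.distrib card_Diff_singleton)
  ultimately show ?thesis
    by simp
qed

lemma sum_powers_root_of_unity: "z ^ n = 1 \<Longrightarrow> z \<noteq> 1 \<Longrightarrow> (\<Sum>k<n. z ^ k) = (0::complex)"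
  by (simp add: sum_gp_strict)

locale mult_generator =
  fixes \<gamma> :: "'a::{field,finite}" and m :: nat
  assumes nonzero: "\<gamma> \<noteq> 0" and bij_power: "bij_betw (\<lambda>k. \<gamma> ^ k) {..<m} (UNIV - {0})"

lemma finite_field_has_generator:
  "\<exists>\<gamma>::'a::{field,finite}. \<gamma> \<noteq> 0 \<and> (\<forall>x. x \<noteq> 0 \<longrightarrow> (\<exists>k::nat. x = \<gamma> ^ k))"
proof -
  interpret field "field_ring :: 'a ring"
    by (rule field_field_ring)
  have "finite (carrier (field_ring :: 'a ring))"
    by simp
  from finite_field_mult_group_has_gen[OF this] obtain \<gamma>
    where "\<gamma> \<in> carrier (mult_of (field_ring :: 'a ring))"
      and gen: "carrier (mult_of field_ring) = {\<gamma> [^]\<^bsub>field_ring\<^esub> k | k::nat. k \<in> UNIV}"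
    by blast
  have carrier: "carrier (field_ring :: 'a ring) = UNIV" and zero: "\<zero>\<^bsub>field_ring\<^esub> = (0::'a)"
    by (simp_all add: field_ring_def)
  have pow: "x [^]\<^bsub>field_ring\<^esub> k = x ^ k" for x :: 'a and k :: nat
    by (induction k) (simp_all add: field_ring_def mult.commute)
  have "\<gamma> \<noteq> 0 \<and> (\<forall>x. x \<noteq> 0 \<longrightarrow> (\<exists>k::nat. x = \<gamma> ^ k))"
    using \<open>\<gamma> \<in> carrier (mult_of field_ring)\<close> gen by (auto simp: carrier zero pow set_eq_iff)
  then show ?thesis
    by blast
qed

lemma mult_generator_exists: "\<exists>\<gamma> m. mult_generator (\<gamma>::'a::{field,finite}) m"
proof -
  obtain \<gamma> :: 'a where "\<gamma> \<noteq> 0" and gen: "\<And>x. x \<noteq> 0 \<Longrightarrow> \<exists>k::nat. x = \<gamma> ^ k"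
    using finite_field_has_generator by blast
  let ?m = "CARD('a) - 1"
  have "card {0::'a, 1} \<le> CARD('a)"
    by (rule card_mono) auto
  then have "?m > 0"
    by simp
  have "(\<lambda>k. \<gamma> ^ k) ` {..<?m} = UNIV - {0}"
  proof (intro equalityI subsetI)
    fix x :: 'a assume "x \<in> UNIV - {0}"
    then obtain k where "x = \<gamma> ^ k"
      using gen by auto
    also have "\<dots> = (\<gamma> ^ ?m) ^ (k div ?m) * \<gamma> ^ (k mod ?m)"
      by (simp flip: power_mult power_add)
    finally have "x = \<gamma> ^ (k mod ?m)"
      using power_card_minus_1[OF \<open>\<gamma> \<noteq> 0\<close>] by simp
    moreover have "k mod ?m < ?m"
      using \<open>?m > 0\<close> by simp
    ultimately show "x \<in> (\<lambda>k. \<gamma> ^ k) ` {..<?m}"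
      by auto
  qed (use \<open>\<gamma> \<noteq> 0\<close> in auto)
  moreover have "card {..<?m} = card (UNIV - {0::'a})"
    by (simp add: card_Diff_singleton)
  ultimately have "bij_betw (\<lambda>k. \<gamma> ^ k) {..<?m} (UNIV - {0})"
    by (simp add: bij_betw_def eq_card_imp_inj_on)
  then show ?thesis
    using \<open>\<gamma> \<noteq> 0\<close> by (auto intro: mult_generator.intro)
qed

context mult_generator
begin

lemma inj_on_power: "inj_on (\<lambda>k. \<gamma> ^ k) {..<m}"
  using bij_power by (rule bij_betw_imp_inj_on)

lemma m_pos: "m > 0"
proof (rule ccontr)
  assume "\<not> m > 0"
  then have "UNIV - {0::'a} = {}"
    using bij_power by (simp add: bij_betw_def)
  moreover have "(1::'a) \<in> UNIV - {0}"
    by simp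
  ultimately show False
    by blast
qed

lemma power_m: "\<gamma> ^ m = 1"
proof -
  have "\<gamma> ^ m \<in> (\<lambda>k. \<gamma> ^ k) ` {..<m}"
    using bij_power nonzero by (simp add: bij_betw_def)
  then obtain k where "k < m" and k: "\<gamma> ^ m = \<gamma> ^ k"
    by auto
  then have "\<gamma> ^ (m - k) * \<gamma> ^ k = 1 * \<gamma> ^ k"
    by (simp flip: power_add)
  then have "\<gamma> ^ (m - k) = \<gamma> ^ 0"
    using nonzero by simp
  have "k = 0"
  proof (rule ccontr)
    assume "k \<noteq> 0"
    then have "m - k = 0"
      using inj_onD[OF inj_on_power \<open>\<gamma> ^ (m - k) = \<gamma> ^ 0\<close>] \<open>k < m\<close> by simp
    with \<open>k < m\<close> show False
      by simp
  qed
  then show ?thesis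
    using k by simp
qed

lemma power_mod_m: "\<gamma> ^ (k mod m) = \<gamma> ^ k"
proof -
  have "\<gamma> ^ k = (\<gamma> ^ m) ^ (k div m) * \<gamma> ^ (k mod m)"
    by (simp flip: power_mult power_add)
  then show ?thesis
    by (simp add: power_m)
qed

definition dlog :: "'a \<Rightarrow> nat" where
  "dlog x = the_inv_into {..<m} (\<lambda>k. \<gamma> ^ k) x"

lemma dlog_power: "dlog (\<gamma> ^ k) = k mod m"
proof -
  have "dlog (\<gamma> ^ (k mod m)) = k mod m"
    using bij_power m_pos by (simp add: dlog_def bij_betw_def the_inv_into_f_f)
  then show ?thesis
    by (simp add: power_mod_m)
qed

lemma power_dlog: "x \<noteq> 0 \<Longrightarrow> \<gamma> ^ dlog x = x"
  using bij_power by (auto simp: dlog_def bij_betw_def intro: f_the_inv_into_f)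

lemma dlog_less: "x \<noteq> 0 \<Longrightarrow> dlog x < m"
  using the_inv_into_into[OF inj_on_power, of x "{..<m}"] bij_power by (simp add: dlog_def bij_betw_def)

lemma dlog_mult: "x \<noteq> 0 \<Longrightarrow> y \<noteq> 0 \<Longrightarrow> dlog (x * y) = (dlog x + dlog y) mod m"
  using dlog_power[of "dlog x + dlog y"] by (simp add: power_add power_dlog)

lemma dlog_1: "dlog 1 = 0"
  using dlog_power[of 0] by simp

definition \<omega> :: complex where
  "\<omega> = exp (2 * of_real pi * \<i> / of_nat m)"

lemma omega_power: "\<omega> ^ k = exp (2 * of_real pi * \<i> * of_nat k / of_nat m)"
  by (simp add: \<omega>_def flip: exp_of_nat_mult) (simp add: field_simps)

lemma omega_power_eq_1_iff: "\<omega> ^ k = 1 \<longleftrightarrow> m dvd k"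
  using complex_root_unity_eq_1[of m k] m_pos by (simp add: omega_power)

lemma omega_power_m: "\<omega> ^ m = 1"
  by (simp add: omega_power_eq_1_iff)

lemma omega_power_mod: "\<omega> ^ (k mod m) = \<omega> ^ k"
proof -
  have "\<omega> ^ k = \<omega> ^ (m * (k div m) + k mod m)"
    by simp
  also have "\<dots> = (\<omega> ^ m) ^ (k div m) * \<omega> ^ (k mod m)"
    by (simp only: power_add power_mult)
  finally show ?thesis
    by (simp add: omega_power_m)
qed

lemma norm_omega [simp]: "norm \<omega> = 1"
  by (simp add: \<omega>_def norm_exp_eq_Re)

definition chi :: "nat \<Rightarrow> 'a \<Rightarrow> complex" where
  "chi j x = (\<omega> ^ dlog x) ^ j"

lemma chi_0 [simp]: "chi 0 x = 1"
  and chi_1 [simp]: "chi j 1 = 1"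
  and norm_chi [simp]: "norm (chi j x) = 1"
  by (simp_all add: chi_def dlog_1 norm_power)

lemma chi_mult:
  assumes "x \<noteq> 0" and "y \<noteq> 0"
  shows "chi j (x * y) = chi j x * chi j y"
proof -
  have "chi j (x * y) = (\<omega> ^ ((dlog x + dlog y) mod m)) ^ j"
    using assms by (simp add: chi_def dlog_mult)
  also have "\<dots> = (\<omega> ^ dlog x * \<omega> ^ dlog y) ^ j"
    by (simp add: omega_power_mod power_add)
  finally show ?thesis
    by (simp add: chi_def power_mult_distrib)
qed

lemma chi_inverse: "x \<noteq> 0 \<Longrightarrow> chi j (inverse x) = cnj (chi j x)"
proof -
  assume "x \<noteq> 0"
  then have inverse: "chi j (inverse x) * chi j x = 1"
    by (simp flip: chi_mult)
  have "chi j x * cnj (chi j x) = 1"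
    by (simp add: complex_norm_square[symmetric])
  then have "chi j (inverse x) = chi j (inverse x) * (chi j x * cnj (chi j x))"
    by simp
  also have "\<dots> = cnj (chi j x)"
    unfolding mult.assoc[symmetric] inverse by simp
  finally show ?thesis .
qed

lemma sum_chi: "0 < j \<Longrightarrow> j < m \<Longrightarrow> (\<Sum>x\<in>UNIV - {0}. chi j x) = 0"
proof -
  assume j: "0 < j" "j < m"
  have "(\<Sum>x\<in>UNIV - {0}. chi j x) = (\<Sum>k<m. chi j (\<gamma> ^ k))"
    using sum.reindex_bij_betw[OF bij_power, of "chi j"] by simp
  also have "\<dots> = (\<Sum>k<m. (\<omega> ^ j) ^ k)"
    by (simp add: chi_def dlog_power omega_power_mod mult.commute flip: power_mult)
  also have "\<dots> = 0"
    using j by (intro sum_powers_root_of_unity)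
      (auto simp: omega_power_eq_1_iff simp flip: power_mult dest: dvd_imp_le)
  finally show ?thesis .
qed

lemma sum_chi_frequencies: "x \<noteq> 0 \<Longrightarrow> (\<Sum>j<m. chi j x) = (if x = 1 then of_nat m else 0)"
proof -
  assume "x \<noteq> 0"
  have "x \<noteq> 1 \<Longrightarrow> dlog x \<noteq> 0"
    using power_dlog[OF \<open>x \<noteq> 0\<close>] by (metis power_0)
  then have "x \<noteq> 1 \<Longrightarrow> (\<Sum>j<m. (\<omega> ^ dlog x) ^ j) = 0"
    using dlog_less[OF \<open>x \<noteq> 0\<close>] by (intro sum_powers_root_of_unity)
      (auto simp: omega_power_eq_1_iff simp flip: power_mult dest: dvd_imp_le)
  then show ?thesis
    by (auto simp: chi_def dlog_1)
qed

section \<open>Fourier analysis on the multiplicative group\<close>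

definition fourier :: "('a \<Rightarrow> real) \<Rightarrow> nat \<Rightarrow> complex" where
  "fourier f j = (\<Sum>x\<in>UNIV - {0}. of_real (f x) * chi j x)"

lemma fourier_linear: "fourier (\<lambda>x. a * f x + b * g x) j = of_real a * fourier f j + of_real b * fourier g j"
  by (simp add: fourier_def sum.distrib sum_distrib_left algebra_simps)

lemma fourier_add_const: "0 < j \<Longrightarrow> j < m \<Longrightarrow> fourier (\<lambda>x. f x + c) j = fourier f j"
  by (simp add: fourier_def sum.distrib algebra_simps sum_chi flip: sum_distrib_left)

lemma fourier_dilate:
  assumes "s \<noteq> 0"
  shows "fourier (\<lambda>x. f (s * x)) j = cnj (chi j s) * fourier f j"
proof -
  have "fourier (\<lambda>x. f (s * x)) j = (\<Sum>z\<in>UNIV - {0}. of_real (f z) * chi j (inverse s * z))"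
    unfolding fourier_def
    by (rule sum.reindex_bij_witness[of _ "\<lambda>z. inverse s * z" "\<lambda>x. s * x"])
      (use assms in \<open>auto simp flip: mult.assoc\<close>)
  also have "\<dots> = (\<Sum>z\<in>UNIV - {0}. cnj (chi j s) * (of_real (f z) * chi j z))"
    using assms by (intro sum.cong refl) (simp add: chi_mult chi_inverse mult_ac)
  finally show ?thesis
    by (simp add: fourier_def sum_distrib_left)
qed

lemma fourier_inversion:
  assumes "t \<noteq> 0"
  shows "(\<Sum>j<m. fourier f j * chi j (inverse t)) = of_nat m * of_real (f t)"
proof -
  have "(\<Sum>j<m. fourier f j * chi j (inverse t)) =
      (\<Sum>j<m. \<Sum>x\<in>UNIV - {0}. of_real (f x) * chi j (x * inverse t))"
    unfolding fourier_def sum_distrib_right using assms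
    by (intro sum.cong refl) (simp add: chi_mult mult.assoc)
  also have "\<dots> = (\<Sum>x\<in>UNIV - {0}. of_real (f x) * (\<Sum>j<m. chi j (x * inverse t)))"
    by (subst sum.swap) (simp add: sum_distrib_left)
  also have "\<dots> = (\<Sum>x\<in>UNIV - {0}. if x = t then of_nat m * of_real (f t) else 0)"
    using assms by (intro sum.cong refl) (auto simp: sum_chi_frequencies field_simps)
  finally show ?thesis
    using assms by simp
qed

lemma eq_if_fourier_vanishes:
  assumes vanish: "\<And>j. 0 < j \<Longrightarrow> j < m \<Longrightarrow> fourier f j = 0" and "x \<noteq> 0" and "y \<noteq> 0"
  shows "f x = f y"
proof -
  have "of_nat m * of_real (f t) = fourier f 0" if "t \<noteq> 0" for t
  proof -
    have "(\<Sum>j<m. fourier f j * chi j (inverse t)) = (\<Sum>j\<in>{0}. fourier f j * chi j (inverse t))"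
      using vanish m_pos by (intro sum.mono_neutral_right) auto
    then show ?thesis
      using fourier_inversion[OF that] by simp
  qed
  then have "of_nat m * (of_real (f x) :: complex) = of_nat m * of_real (f y)"
    using assms(2,3) by simp
  then show ?thesis
    using m_pos by simp
qed

lemma fourier_weyl_step:
  assumes "0 < j" and "j < m"
  shows "fourier (fst (weyl_step p st)) j =
      of_real (1 - p) * fourier (fst st) j + of_real (p / CARD('a)) * fourier (snd st) j"
    and "fourier (snd (weyl_step p st)) j = of_real (1 - p) * fourier (snd st) j + of_real p * fourier (fst st) j"
proof -
  obtain g h where st: "st = (g, h)"
    by (cases st)
  have "fst (weyl_step p st) =
      (\<lambda>y. ((1 - p) * g y + p / CARD('a) * h y) + p / CARD('a) * (\<Sum>z\<in>UNIV - {0}. g z))"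
    by (simp add: st fun_eq_iff algebra_simps)
  then show "fourier (fst (weyl_step p st)) j =
      of_real (1 - p) * fourier (fst st) j + of_real (p / CARD('a)) * fourier (snd st) j"
    by (simp only: fourier_add_const[OF assms] fourier_linear st fst_conv snd_conv)
  show "fourier (snd (weyl_step p st)) j = of_real (1 - p) * fourier (snd st) j + of_real p * fourier (fst st) j"
    by (simp add: st fourier_linear)
qed

lemma fourier_diag_step:
  assumes "s \<noteq> 0"
  shows "fourier (fst (diag_step s p st)) j = (of_real (1 - p) + of_real p * cnj (chi j s)) * fourier (fst st) j"
    and "fourier (snd (diag_step s p st)) j = (of_real (1 - p) + of_real p * chi j s) * fourier (snd st) j"
proof -
  obtain g h where st: "st = (g, h)"
    by (cases st)
  have "inverse s \<noteq> 0"
    using assms by simp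
  have "fourier (fst (diag_step s p st)) j =
      of_real (1 - p) * fourier g j + of_real p * (cnj (chi j s) * fourier g j)"
    by (simp only: st diag_step.simps fst_conv fourier_linear fourier_dilate[OF assms])
  then show "fourier (fst (diag_step s p st)) j = (of_real (1 - p) + of_real p * cnj (chi j s)) * fourier (fst st) j"
    by (simp add: st algebra_simps)
  have "fourier (snd (diag_step s p st)) j =
      of_real (1 - p) * fourier h j + of_real p * (cnj (chi j (inverse s)) * fourier h j)"
    by (simp only: st diag_step.simps snd_conv fourier_linear fourier_dilate[OF \<open>inverse s \<noteq> 0\<close>])
  then show "fourier (snd (diag_step s p st)) j = (of_real (1 - p) + of_real p * chi j s) * fourier (snd st) j"
    using assms by (simp add: st chi_inverse algebra_simps)
qed

definition aligned :: "nat \<Rightarrow> 'a orbit_data \<Rightarrow> bool" where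
  "aligned j st \<longleftrightarrow> fourier (snd st) j = of_real (sqrt CARD('a)) * fourier (fst st) j"

lemma aligned_weyl_step:
  assumes "0 < j" and "j < m"
  shows "aligned j (weyl_step (balance CARD('a)) st)"
proof -
  let ?r = "sqrt CARD('a)" and ?b = "balance CARD('a)"
  let ?A = "fourier (fst st) j" and ?B = "fourier (snd st) j"
  have "of_real ?r * (of_real (1 - ?b) * ?A + of_real (?b / CARD('a)) * ?B) =
      of_real (?r * (1 - ?b)) * ?A + of_real (?r * (?b / CARD('a))) * ?B"
    by (simp add: algebra_simps)
  also have "\<dots> = of_real (1 - ?b) * ?B + of_real ?b * ?A"
    by (simp only: balance_identities of_nat_0_less_iff zero_less_card_finite add.commute)
  finally show ?thesis
    unfolding aligned_def fourier_weyl_step[OF assms] by simp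
qed

lemma fourier_weyl_diag_step:
  assumes "0 < j" and "j < m" and "s \<noteq> 0" and "aligned j st"
  shows "fourier (fst (weyl_step (balance CARD('a)) (diag_step s p st))) j =
    of_real (2 * (1 - balance CARD('a)) * (1 - p + p * Re (chi j s))) * fourier (fst st) j"
proof -
  let ?b = "balance CARD('a)" and ?c = "chi j s" and ?A = "fourier (fst st) j"
  have B: "fourier (snd st) j = of_real (sqrt CARD('a)) * ?A"
    using assms(4) by (simp add: aligned_def)
  have "fourier (fst (weyl_step ?b (diag_step s p st))) j =
      of_real (1 - ?b) * ((of_real (1 - p) + of_real p * cnj ?c) * ?A) +
      of_real (?b / CARD('a)) * ((of_real (1 - p) + of_real p * ?c) * (of_real (sqrt CARD('a)) * ?A))"
    unfolding fourier_weyl_step[OF assms(1,2)] fourier_diag_step[OF assms(3)] B ..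
  also have "\<dots> = of_real (1 - ?b) * ((of_real (1 - p) + of_real p * cnj ?c) * ?A) +
      of_real (sqrt CARD('a) * (?b / CARD('a))) * ((of_real (1 - p) + of_real p * ?c) * ?A)"
    by (simp add: algebra_simps)
  also have "\<dots> = of_real (1 - ?b) * (of_real (2 * (1 - p)) + of_real p * (?c + cnj ?c)) * ?A"
    by (simp only: balance_identities of_nat_0_less_iff zero_less_card_finite) (simp add: algebra_simps)
  also have "?c + cnj ?c = of_real (2 * Re ?c)"
    by (rule complex_add_cnj)
  finally show ?thesis
    by (simp add: algebra_simps)
qed

section \<open>The equidistributing walk\<close>

definition kill_point :: "nat \<Rightarrow> 'a" where
  "kill_point k = (SOME s. s \<noteq> 0 \<and> Re (chi k s) \<le> 0)"

definition kill_prob :: "nat \<Rightarrow> real" where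
  "kill_prob k = 1 / (1 - Re (chi k (kill_point k)))"

lemma kill_point:
  assumes "0 < k" and "k < m"
  shows "kill_point k \<noteq> 0" and "Re (chi k (kill_point k)) \<le> 0"
proof -
  have "\<exists>s. s \<noteq> 0 \<and> Re (chi k s) \<le> 0"
  proof (rule ccontr)
    assume "\<nexists>s. s \<noteq> 0 \<and> Re (chi k s) \<le> 0"
    moreover have "(1::'a) \<in> UNIV - {0}"
      by simp
    then have "UNIV - {0::'a} \<noteq> {}"
      by blast
    ultimately have "(\<Sum>s\<in>UNIV - {0}. Re (chi k s)) > 0"
      by (intro sum_pos) (auto simp: not_le)
    then show False
      using sum_chi[OF assms] by (simp flip: Re_sum)
  qed
  then have "kill_point k \<noteq> 0 \<and> Re (chi k (kill_point k)) \<le> 0"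
    unfolding kill_point_def by (rule someI_ex)
  then show "kill_point k \<noteq> 0" and "Re (chi k (kill_point k)) \<le> 0"
    by simp_all
qed

lemma kill_prob:
  assumes "0 < k" and "k < m"
  shows "0 \<le> kill_prob k" and "kill_prob k \<le> 1"
    and "1 - kill_prob k + kill_prob k * Re (chi k (kill_point k)) = 0"
  using kill_point(2)[OF assms] by (simp_all add: kill_prob_def field_simps)

definition link_step :: "nat \<Rightarrow> 'a orbit_data \<Rightarrow> 'a orbit_data" where
  "link_step k st = weyl_step (balance CARD('a)) (diag_step (kill_point k) (kill_prob k) st)"

lemma aligned_fold_link_step:
  "0 < j \<Longrightarrow> j < m \<Longrightarrow> aligned j st \<Longrightarrow> aligned j (fold link_step ks st)"
  by (induction ks arbitrary: st) (simp_all add: link_step_def aligned_weyl_step)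

lemma fourier_fold_link_step:
  assumes "0 < j" and "j < m" and "\<forall>k\<in>set ks. 0 < k \<and> k < m" and "aligned j st"
    and "fourier (fst st) j = 0 \<or> j \<in> set ks"
  shows "fourier (fst (fold link_step ks st)) j = 0"
  using assms(3-)
proof (induction ks arbitrary: st)
  case (Cons k ks)
  then have k: "0 < k" "k < m"
    by simp_all
  have step: "fourier (fst (link_step k st)) j =
      of_real (2 * (1 - balance CARD('a)) * (1 - kill_prob k + kill_prob k * Re (chi j (kill_point k)))) *
      fourier (fst st) j"
    unfolding link_step_def by (rule fourier_weyl_diag_step[OF assms(1,2) kill_point(1)[OF k] Cons.prems(2)])
  have "fourier (fst (link_step k st)) j = 0 \<or> j \<in> set ks"
  proof (cases "j = k")
    case True
    have "fourier (fst (link_step k st)) k = of_real (2 * (1 - balance CARD('a)) * 0) * fourier (fst st) k"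
      using step unfolding True kill_prob(3)[OF k] .
    then show ?thesis
      using True by simp
  next
    case False
    then show ?thesis
      using Cons.prems(3) step by auto
  qed
  then show ?case
    using Cons.IH[of "link_step k st"] Cons.prems(1) aligned_weyl_step[OF assms(1,2)]
    by (simp add: link_step_def)
qed simp

definition link_steps :: "nat list \<Rightarrow> (('a^2^2) \<times> real) list" where
  "link_steps ks =
    concat (map (\<lambda>k. weyl_steps (balance CARD('a)) @ [(diag (kill_point k), kill_prob k)]) (rev ks))"

lemma walk_link_steps:
  assumes "CHAR('a) = 2" and "\<forall>k\<in>set ks. 0 < k \<and> k < m"
  shows "walk act (link_steps ks) (orbit_fun st) = orbit_fun (fold link_step ks st)"
  using assms(2)
proof (induction ks arbitrary: st)
  case (Cons k ks)
  then have "kill_point k \<noteq> 0"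
    by (simp add: kill_point)
  then have "walk act (weyl_steps (balance CARD('a)) @ [(diag (kill_point k), kill_prob k)]) (orbit_fun st) =
      orbit_fun (link_step k st)"
    by (cases st) (simp add: walk_append walk_diag_orbit_fun walk_weyl_steps_orbit_fun[OF assms(1)]
        link_step_def del: walk_Cons)
  then show ?case
    using Cons by (simp add: link_steps_def walk_append del: walk_Cons)
qed (simp add: link_steps_def)

lemma valid_link_steps:
  assumes "CHAR('a) = 2" and "\<forall>k\<in>set ks. 0 < k \<and> k < m"
  shows "\<forall>(g, p)\<in>set (link_steps ks). det g = 1 \<and> 0 \<le> p \<and> p \<le> 1"
  using valid_weyl_steps[OF assms(1), of "balance CARD('a)"] balance_bounds[of "real CARD('a)"]
    assms(2) kill_point(1) kill_prob(1,2)
  by (auto simp: link_steps_def det_diag)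

text \<open>The walk applies the rightmost steps first: balance, kill every nontrivial frequency, then
  equalize the two components.\<close>
definition equidistributing_steps :: "(('a^2^2) \<times> real) list" where
  "equidistributing_steps = weyl_steps (real CARD('a) / (real CARD('a) + 1)) @ link_steps [1..<m] @
    weyl_steps (balance CARD('a))"

lemma valid_equidistributing_steps:
  assumes "CHAR('a) = 2"
  shows "\<forall>(g, p)\<in>set equidistributing_steps. det g = 1 \<and> 0 \<le> p \<and> p \<le> 1"
  using valid_link_steps[OF assms, of "[1..<m]"] valid_weyl_steps[OF assms, of "balance CARD('a)"]
    valid_weyl_steps[OF assms, of "real CARD('a) / (real CARD('a) + 1)"] balance_bounds[of "real CARD('a)"]
  by (auto simp: equidistributing_steps_def)

lemma walk_equidistributing_steps:
  assumes "CHAR('a) = 2"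
  shows "\<exists>K. \<forall>v. v \<noteq> (0, 0) \<longrightarrow> walk act equidistributing_steps (orbit_fun st) v = K"
proof -
  define st' where "st' = fold link_step [1..<m] (weyl_step (balance CARD('a)) st)"
  let ?p = "real CARD('a) / (real CARD('a) + 1)"
  have walk: "walk act equidistributing_steps (orbit_fun st) = orbit_fun (weyl_step ?p (fst st', snd st'))"
    by (simp add: equidistributing_steps_def walk_append walk_weyl_steps_orbit_fun[OF assms]
        walk_link_steps[OF assms] st'_def del: walk_Cons)
  have vanish: "fourier (fst st') j = 0" "fourier (snd st') j = 0" if "0 < j" and "j < m" for j
  proof -
    have aligned: "aligned j (weyl_step (balance CARD('a)) st)"
      using aligned_weyl_step that .
    show "fourier (fst st') j = 0"
      unfolding st'_def using that by (intro fourier_fold_link_step aligned) auto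
    then show "fourier (snd st') j = 0"
      using aligned_fold_link_step[OF that aligned] by (simp add: st'_def aligned_def)
  qed
  have "walk act equidistributing_steps (orbit_fun st) v =
      (real CARD('a) * fst st' 1 + snd st' 1) / (real CARD('a) + 1)" if "v \<noteq> (0, 0)" for v
    unfolding walk using that vanish by (intro orbit_fun_weyl_step_equalizes eq_if_fourier_vanishes) auto
  then show ?thesis
    by blast
qed

lemma pushforward_first_column_equidistributing_walk:
  assumes "CHAR('a) = 2"
  shows "\<exists>K. \<forall>v. v \<noteq> (0, 0) \<longrightarrow>
    pushforward first_column (walk (**) (equidistributing_steps @ unipotent_steps) (indicator {mat 1})) v = K"
proof -
  have "\<forall>(g, p)\<in>set (equidistributing_steps @ unipotent_steps). det g = 1"
    using valid_equidistributing_steps[OF assms] valid_unipotent_steps by fastforce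
  then have "pushforward first_column (walk (**) (equidistributing_steps @ unipotent_steps) (indicator {mat 1})) =
      walk act equidistributing_steps (orbit_fun (\<lambda>_. 0, indicator {1}))"
    by (simp add: pushforward_first_column_walk pushforward_first_column_indicator_1 walk_append
        walk_unipotent_steps_indicator[OF assms] del: walk_Cons)
  then show ?thesis
    using walk_equidistributing_steps[OF assms] by simp
qed

end

theorem mainTheorem5:
  fixes n :: nat
  assumes "n \<ge> 1" and "CARD('a::{field,finite}) = 2 ^ n"
  shows "mixable (PSL2 :: ('a^2^2) set monoid)"
proof -
  have char: "CHAR('a) = 2"
    using assms(2) by (rule CHAR_eq_2_if_CARD_eq_power_2)
  obtain \<gamma> m where "mult_generator (\<gamma>::'a) m"
    using mult_generator_exists by blast
  then interpret mult_generator \<gamma> m .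
  have valid: "\<forall>(g, p)\<in>set (equidistributing_steps @ unipotent_steps). det g = 1 \<and> 0 \<le> p \<and> p \<le> 1"
    using valid_equidistributing_steps[OF char] valid_unipotent_steps by auto
  obtain K where "\<And>v. v \<noteq> (0, 0) \<Longrightarrow>
      pushforward first_column (walk (**) (equidistributing_steps @ unipotent_steps) (indicator {mat 1})) v = K"
    using pushforward_first_column_equidistributing_walk[OF char] by blast
  then have "\<forall>C::'a^2^2. det C = 1 \<longrightarrow>
      walk (**) (equidistributing_steps @ unipotent_steps) (indicator {mat 1}) C = 1 / card {C::'a^2^2. det C = 1}"
    using valid_equidistributing_steps[OF char] by (intro walk_uniform_if_pushforward_constant[OF char]) auto
  then show ?thesis
    by (rule mixable_PSL2_if_walk_uniform[OF char valid])
qed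

end
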